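(* Let $\theta\in(0,\tfrac{\pi}{6})$, $c_0>0$, and let $\mathbf{A}=(A_1,A_2,A_3)\in\mathbb{R}^3$ be such that $(\mathbf{A},\mathbf{0})$ is an equilibrium of the spatial-dynamics system (T). If the linearisation of the Landau equations (La) about $\mathbf{A}$ has $n$ unstable eigenvalues with $0\le n\le3$ and $3-n$ stable eigenvalues, then the linearisation $\mathfrak{L}(\mathbf{A})\in\mathbb{R}^{6\times6}$ of (T) about the corresponding equilibrium has $3+n$ stable eigenvalues and $3-n$ unstable eigenvalues. In particular, if $\mathbf{A}$ is PDE-stable, then $\mathfrak{L}(\mathbf{A})$ has three eigenvalues with negative real parts and three with positive real parts.
   Context: $\mathbf{d}=(\cos\theta,\sin\theta)$, $\mathbf{k}_1=(1,0)$, $\mathbf{k}_2=\tfrac12(-1,\sqrt3)$, $\mathbf{k}_3=-\tfrac12(1,\sqrt3)$; $\mu_0,\beta_2,K_0,K_2\in\mathbb{R}$. System (T), for real-valued unknowns: for $\{j,l,m\}=\{1,2,3\}$, $$\partial_\Xi A_j=B_j,\qquad 4(\mathbf{d}\cdot\mathbf{k}_j)^2\,\partial_\Xi B_j=-\mu_0A_j-c_0B_j-\beta_2A_lA_m-\big(K_0A_j^2+K_2(A_l^2+A_m^2)\big)A_j.$$ Landau equations (La), for $\mathbf{A}\in\mathbb{R}^3$: $\partial_TA_j=\mu_0A_j+\beta_2A_lA_m+(K_0A_j^2+K_2(A_l^2+A_m^2))A_j$. An equilibrium $\mathbf{A}$ is PDE-stable if all eigenvalues of the ($3\times3$) linearisation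 of (La) about $\mathbf{A}$ have negative real part. An eigenvalue is stable (unstable) if its real part is negative (positive); eigenvalues are counted with multiplicity. *)

theory Defs
  imports "HOL-Analysis.Analysis" "HOL-Computational_Algebra.Polynomial"
begin

definition char_polynomial :: "real ^ 'n ^ 'n \<Rightarrow> complex poly" where
  "char_polynomial M =
     det (\<chi> i j. (if i = j then [:0, 1:] else 0) - [:complex_of_real (M $ i $ j):])"

definition is_eigenvalue :: "real ^ 'n ^ 'n \<Rightarrow> complex \<Rightarrow> bool" where
  "is_eigenvalue M z \<longleftrightarrow>
     (\<exists>v. v \<noteq> 0 \<and> map_matrix complex_of_real M *v v = z *s v)"

definition alg_multiplicity :: "real ^ 'n ^ 'n \<Rightarrow> complex \<Rightarrow> nat" where
  "alg_multiplicity M z = order z (char_polynomial M)"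

definition num_stable :: "real ^ 'n ^ 'n \<Rightarrow> nat" where
  "num_stable M = (\<Sum>z | is_eigenvalue M z \<and> Re z < 0. alg_multiplicity M z)"

definition num_unstable :: "real ^ 'n ^ 'n \<Rightarrow> nat" where
  "num_unstable M = (\<Sum>z | is_eigenvalue M z \<and> Re z > 0. alg_multiplicity M z)"

definition dir :: "real \<Rightarrow> real ^ 2" where
  "dir \<theta> = vector [cos \<theta>, sin \<theta>]"

definition wavevec :: "3 \<Rightarrow> real ^ 2" where
  "wavevec j =
     (if j = 1 then vector [1, 0]
      else if j = 2 then (1/2) *\<^sub>R vector [-1, sqrt 3]
      else - (1/2) *\<^sub>R vector [1, sqrt 3])"

text \<open>
  Arithmetic in the index type \<open>3\<close> is modulo 3, so \<open>j\<close>, \<open>j + 1\<close>, \<open>j + 2\<close> are the three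
  distinct indices; \<open>j + 1\<close> and \<open>j + 2\<close> play the roles of \<open>l\<close> and \<open>m\<close>, in which the
  equations are symmetric.
\<close>

definition landau_field :: "real \<Rightarrow> real \<Rightarrow> real \<Rightarrow> real \<Rightarrow> real ^ 3 \<Rightarrow> real ^ 3" where
  "landau_field \<mu>0 \<beta>2 K0 K2 A =
     (\<chi> j. \<mu>0 * A $ j + \<beta>2 * A $ (j + 1) * A $ (j + 2)
        + (K0 * (A $ j)\<^sup>2 + K2 * ((A $ (j + 1))\<^sup>2 + (A $ (j + 2))\<^sup>2)) * A $ j)"

text \<open>
  The phase space of the spatial dynamics is six-dimensional; its coordinates are indexed by
  the sum type \<open>3 + 3\<close>, with \<open>Inl j\<close> standing for the coordinate \<open>A\<^sub>j\<close> and \<open>Inr j\<close> for \<open>B\<^sub>j\<close>.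
\<close>

definition phase_point :: "real ^ 3 \<Rightarrow> real ^ 3 \<Rightarrow> real ^ (3 + 3)" where
  "phase_point A B = (\<chi> i. case i of Inl j \<Rightarrow> A $ j | Inr j \<Rightarrow> B $ j)"

definition A_part :: "real ^ (3 + 3) \<Rightarrow> real ^ 3" where
  "A_part u = (\<chi> j. u $ Inl j)"

definition B_part :: "real ^ (3 + 3) \<Rightarrow> real ^ 3" where
  "B_part u = (\<chi> j. u $ Inr j)"

text \<open>
  The spatial dynamics is written in the solved form \<open>\<partial>\<^sub>\<Xi> u = spatial_field \<dots> u\<close>, dividing
  the equation for \<open>B\<^sub>j\<close> by \<open>4 (d \<bullet> k\<^sub>j)\<^sup>2\<close>, which is positive for all \<open>j\<close> when
  \<open>0 < \<theta> < \<pi>/6\<close>.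
\<close>

definition spatial_field ::
  "real \<Rightarrow> real \<Rightarrow> real \<Rightarrow> real \<Rightarrow> real \<Rightarrow> real \<Rightarrow> real ^ (3 + 3) \<Rightarrow> real ^ (3 + 3)" where
  "spatial_field \<theta> c0 \<mu>0 \<beta>2 K0 K2 u =
     (let A = A_part u; B = B_part u in
      phase_point B
        (\<chi> j. (- \<mu>0 * A $ j - c0 * B $ j - \<beta>2 * A $ (j + 1) * A $ (j + 2)
               - (K0 * (A $ j)\<^sup>2 + K2 * ((A $ (j + 1))\<^sup>2 + (A $ (j + 2))\<^sup>2)) * A $ j)
              / (4 * (dir \<theta> \<bullet> wavevec j)\<^sup>2)))"

definition is_equilibrium :: "('a::zero \<Rightarrow> 'a) \<Rightarrow> 'a \<Rightarrow> bool" where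
  "is_equilibrium F u \<longleftrightarrow> F u = 0"

definition linearisation :: "(real ^ 'n \<Rightarrow> real ^ 'n) \<Rightarrow> real ^ 'n \<Rightarrow> real ^ 'n ^ 'n" where
  "linearisation F u = jacobian F (at u)"

definition pde_stable :: "real \<Rightarrow> real \<Rightarrow> real \<Rightarrow> real \<Rightarrow> real ^ 3 \<Rightarrow> bool" where
  "pde_stable \<mu>0 \<beta>2 K0 K2 A \<longleftrightarrow>
     is_equilibrium (landau_field \<mu>0 \<beta>2 K0 K2) A \<and>
     (\<forall>z. is_eigenvalue (linearisation (landau_field \<mu>0 \<beta>2 K0 K2) A) z \<longrightarrow> Re z < 0)"

end

theory Submission
  imports Defs "HOL-Computational_Algebra.Fundamental_Theorem_Algebra"
begin

text \<open>
  The linearisation \<open>J\<close> of the Landau equations is a real symmetric matrix, because these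
  equations are a gradient system. The linearised spatial dynamics is the damped oscillator
  \<open>D a'' + c\<^sub>0 a' + J a = 0\<close>, where \<open>D\<close> is diagonal with the entries \<open>4 (d \<bullet> k\<^sub>j)\<^sup>2\<close>, all of
  them positive for \<open>\<theta>\<close> in the given range (\<open>dir_wavevec_nonzero\<close>). The result is thus
  an inertia theorem for such oscillators, \<open>second_order_inertia\<close>: if \<open>J\<close> is nonsingular of
  size \<open>n\<close>, the number of stable eigenvalues is \<open>n\<close> plus the number of unstable eigenvalues of
  \<open>J\<close>.

  If \<open>D\<close> is the identity, the characteristic polynomial of the oscillator is the product of
  \<open>z\<^sup>2 + c\<^sub>0 z + \<mu>\<close> over the eigenvalues \<open>\<mu>\<close> of \<open>J\<close>, which are real. Such a quadratic has two
  stable roots if \<open>\<mu> > 0\<close> and one stable and one unstable root if \<open>\<mu> < 0\<close>. The factorisation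
  (\<open>char_polynomial_second_order\<close>) is a determinant identity, so it respects multiplicities.

  A general \<open>D\<close> is deformed to the identity through positive diagonal matrices. Damping keeps
  the eigenvalues off the imaginary axis all along (\<open>second_order_not_imaginary\<close>): an imaginary
  eigenvalue would make the dissipated energy \<open>c\<^sub>0 |a'|\<^sup>2\<close> vanish, forcing a kernel vector of \<open>J\<close>.
  Since roots depend continuously on the matrix, the number of stable ones cannot change
  (\<open>num_stable_homotopy\<close>).
\<close>

section \<open>Characteristic polynomials and eigenvalue counts\<close>

lemma poly_det:
  fixes M :: "('a::comm_ring_1 poly) ^ 'n ^ 'n"
  shows "poly (det M) z = det (\<chi> i j. poly (M $ i $ j) z)"
proof -
  have sgn: "poly (of_int (sign p)) z = of_int (sign p)" for p :: "'n \<Rightarrow> 'n"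
    by (simp add: sign_def)
  show ?thesis
    by (simp add: det_def poly_sum poly_prod sgn)
qed

lemma poly_char_polynomial:
  "poly (char_polynomial M) z = det (mat z - map_matrix complex_of_real M)"
  unfolding char_polynomial_def poly_det
  by (rule arg_cong[where f = det]) (simp add: vec_eq_iff mat_def)

text \<open>
  In the Leibniz expansion only the identity permutation meets every diagonal entry; every other
  term misses some diagonal entry and so has smaller degree.
\<close>

lemma char_polynomial_degree_monic:
  fixes M :: "real ^ 'n ^ 'n"
  shows "degree (char_polynomial M) = CARD('n)" "lead_coeff (char_polynomial M) = 1"
proof -
  define X where "X i j = (if i = j then [:0, 1:] else 0) - [:complex_of_real (M $ i $ j):]"
    for i j :: 'n
  define tm where "tm p = of_int (sign p) * (\<Prod>i\<in>UNIV. X i (p i))" for p :: "'n \<Rightarrow> 'n"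
  have deg: "degree (X i j) = (if i = j then 1 else 0)" for i j
    by (simp add: X_def)
  have lead: "lead_coeff (X i i) = 1" for i
    by (simp add: X_def)
  have nz: "X i i \<noteq> 0" for i
    using lead[of i] by auto
  have d_id: "degree (tm id) = CARD('n)"
    using nz by (simp add: tm_def degree_prod_eq_sum_degree deg)
  have l_id: "lead_coeff (tm id) = 1"
    by (simp only: tm_def sign_id of_int_1 mult_1 id_apply lead_coeff_prod lead prod.neutral_const)
  have d_other: "degree (tm p) < CARD('n)" if "p \<noteq> id" for p
  proof -
    from that obtain k where k: "p k \<noteq> k" by (auto simp: fun_eq_iff)
    have "degree (tm p) \<le> degree (of_int (sign p) :: complex poly)
             + degree (\<Prod>i\<in>UNIV. X i (p i))"
      unfolding tm_def by (rule degree_mult_le)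
    also have "degree (of_int (sign p) :: complex poly) = 0" by (simp add: sign_def)
    also have "degree (\<Prod>i\<in>UNIV. X i (p i)) \<le> (\<Sum>i\<in>UNIV. degree (X i (p i)))"
      using degree_prod_sum_le[of UNIV "\<lambda>i. X i (p i)"] by (simp add: o_def)
    also have "\<dots> < (\<Sum>i\<in>(UNIV :: 'n set). 1)"
      by (rule sum_strict_mono_ex1) (use k in \<open>auto simp: deg intro!: exI[of _ k]\<close>)
    finally show ?thesis by simp
  qed
  let ?P = "{p :: 'n \<Rightarrow> 'n. p permutes UNIV}"
  have fin: "finite ?P" by (simp add: finite_permutations)
  have split: "char_polynomial M = tm id + (\<Sum>p\<in>?P - {id}. tm p)"
    unfolding char_polynomial_def det_def
    by (subst sum.remove[OF fin, of id]) (auto simp: tm_def X_def permutes_id)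
  have small: "degree (\<Sum>p\<in>?P - {id}. tm p) < degree (tm id)"
    unfolding d_id by (rule degree_sum_less) (use d_other in auto)
  show deg: "degree (char_polynomial M) = CARD('n)"
    unfolding split using degree_add_eq_left[OF small] d_id by simp
  have "coeff (\<Sum>p\<in>?P - {id}. tm p) CARD('n) = 0"
    using small d_id by (simp add: coeff_eq_0)
  then show "lead_coeff (char_polynomial M) = 1"
    unfolding deg using l_id d_id by (simp add: split)
qed

lemma char_polynomial_nonzero: "char_polynomial M \<noteq> 0"
  using char_polynomial_degree_monic(2)[of M] by auto

lemma is_eigenvalue_iff_root: "is_eigenvalue M z \<longleftrightarrow> poly (char_polynomial M) z = 0"
proof -
  let ?C = "map_matrix complex_of_real M"
  have "(mat z - ?C) *v v = z *s v - ?C *v v" for v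
  proof -
    have "mat z *v v = z *s v"
      by (simp add: vec_eq_iff matrix_vector_mult_def mat_def if_distrib[of "\<lambda>x. x * _"]
          cong: if_cong)
    then show ?thesis by (simp add: matrix_vector_mult_diff_rdistrib)
  qed
  then have "is_eigenvalue M z \<longleftrightarrow> (\<exists>v. v \<noteq> 0 \<and> (mat z - ?C) *v v = 0)"
    unfolding is_eigenvalue_def by auto
  also have "\<dots> \<longleftrightarrow> \<not> invertible (mat z - ?C)"
    unfolding invertible_left_inverse matrix_left_invertible_ker by blast
  also have "\<dots> \<longleftrightarrow> poly (char_polynomial M) z = 0"
    by (simp add: invertible_det_nz poly_char_polynomial)
  finally show ?thesis .
qed

text \<open>
  The counts in the definitions of stability are sums of multiplicities over sets of
  eigenvalues. Read as sizes of submultisets of the root multiset, they become additive under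
  multiplication of polynomials, which is how the count is computed for an explicit product.
\<close>

lemma sum_alg_multiplicity:
  "(\<Sum>z | is_eigenvalue M z \<and> P z. alg_multiplicity M z)
     = size (filter_mset P (proots (char_polynomial M)))"
proof -
  have "set_mset (filter_mset P (proots (char_polynomial M))) = {z. is_eigenvalue M z \<and> P z}"
    by (auto simp: char_polynomial_nonzero is_eigenvalue_iff_root)
  then show ?thesis
    unfolding size_multiset_overloaded_eq
    by (auto intro!: sum.cong simp: alg_multiplicity_def char_polynomial_nonzero)
qed

lemma num_stable_proots:
  "num_stable M = size {#z \<in># proots (char_polynomial M). Re z < 0#}"
  unfolding num_stable_def by (rule sum_alg_multiplicity)

lemma num_unstable_proots:
  "num_unstable M = size {#z \<in># proots (char_polynomial M). Re z > 0#}"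
  unfolding num_unstable_def by (rule sum_alg_multiplicity)

lemma num_stable_add_num_unstable:
  fixes M :: "real ^ 'n ^ 'n"
  shows "num_stable M + num_unstable M
           + size {#z \<in># proots (char_polynomial M). Re z = 0#} = CARD('n)"
proof -
  have "size {#z \<in># A. Re z < 0#} + size {#z \<in># A. Re z > 0#} + size {#z \<in># A. Re z = 0#} = size A"
    for A :: "complex multiset"
    by (induction A) auto
  then show ?thesis
    by (simp add: num_stable_proots num_unstable_proots size_proots_complex
        char_polynomial_degree_monic)
qed

text \<open>
  The hypothesis that an equilibrium is hyperbolic is expressed by the two counts adding up to
  the dimension.
\<close>

lemma num_stable_add_num_unstable_iff:
  fixes M :: "real ^ 'n ^ 'n"
  shows "num_stable M + num_unstable M = CARD('n) \<longleftrightarrow> (\<forall>z. is_eigenvalue M z \<longrightarrow> Re z \<noteq> 0)"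
proof -
  have "num_stable M + num_unstable M = CARD('n)
          \<longleftrightarrow> {#z \<in># proots (char_polynomial M). Re z = 0#} = {#}"
    using num_stable_add_num_unstable[of M]
    by (metis add_0_right add_left_cancel size_eq_0_iff_empty)
  also have "\<dots> \<longleftrightarrow> (\<forall>z. is_eigenvalue M z \<longrightarrow> Re z \<noteq> 0)"
    using set_count_proots[OF char_polynomial_nonzero[of M]]
    by (auto simp: filter_mset_eq_mempty_iff is_eigenvalue_iff_root)
  finally show ?thesis .
qed

section \<open>Continuity of the eigenvalue count\<close>

text \<open>
  Listing the roots, with multiplicity, as a vector indexed by \<open>'n\<close> puts them in a
  finite-dimensional space, where bounded sequences of root vectors have convergent subsequences.
\<close>

lemma char_polynomial_roots_vec:
  fixes M :: "real ^ 'n ^ 'n"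
  obtains r :: "complex ^ 'n" where "char_polynomial M = (\<Prod>i\<in>UNIV. [:- (r $ i), 1:])"
proof -
  obtain root where root: "(\<Prod>i<CARD('n). [:- root i, 1:]) = char_polynomial M"
    using complex_poly_decompose'[of "char_polynomial M"]
    by (metis char_polynomial_degree_monic smult_1_left)
  obtain h :: "'n \<Rightarrow> nat" where h: "bij_betw h UNIV {..<CARD('n)}"
    using ex_bij_betw_finite_nat[of "UNIV :: 'n set"] by (auto simp: atLeast0LessThan)
  have "char_polynomial M = (\<Prod>i\<in>UNIV. [:- (root (h i)), 1:])"
    unfolding root[symmetric] by (rule prod.reindex_bij_betw[OF h, symmetric])
  then show thesis
    by (intro that[of "\<chi> i. root (h i)"]) simp
qed

lemma proots_prod_linear:
  "proots (\<Prod>i\<in>UNIV. [:- (r $ i), 1:]) = image_mset (\<lambda>i. r $ i) (mset_set UNIV)"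
  for r :: "complex ^ 'n"
  by (subst proots_prod) (auto simp: sum_unfold_sum_mset)

lemma num_stable_roots_vec:
  fixes M :: "real ^ 'n ^ 'n"
  assumes "char_polynomial M = (\<Prod>i\<in>UNIV. [:- (r $ i), 1:])"
  shows "num_stable M = card {i. Re (r $ i) < 0}"
  unfolding num_stable_proots assms proots_prod_linear
  by (simp add: filter_mset_image_mset)

lemma num_unstable_roots_vec:
  fixes M :: "real ^ 'n ^ 'n"
  assumes "char_polynomial M = (\<Prod>i\<in>UNIV. [:- (r $ i), 1:])"
  shows "num_unstable M = card {i. Re (r $ i) > 0}"
  unfolding num_unstable_proots assms proots_prod_linear
  by (simp add: filter_mset_image_mset)

lemma eigenvalue_norm_le:
  fixes M :: "real ^ 'n ^ 'n"
  assumes "is_eigenvalue M z"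
  shows "norm z \<le> (\<Sum>i\<in>UNIV. \<Sum>j\<in>UNIV. \<bar>M $ i $ j\<bar>)"
proof -
  from assms obtain v where v: "v \<noteq> 0" and eq: "map_matrix complex_of_real M *v v = z *s v"
    unfolding is_eigenvalue_def by blast
  \<comment> \<open>Compare both sides at a coordinate where \<open>v\<close> is largest.\<close>
  obtain k where k: "\<And>j. norm (v $ j) \<le> norm (v $ k)"
    proof -
    let ?N = "range (\<lambda>j. norm (v $ j))"
    have "Max ?N \<in> ?N" by (intro Max_in) auto
    then obtain k where "norm (v $ k) = Max ?N" by (metis rangeE)
    then show thesis by (intro that[of k]) simp
  qed
  have pos: "norm (v $ k) > 0"
    using v k by (auto simp: vec_eq_iff)
  have "norm z * norm (v $ k) = norm ((map_matrix complex_of_real M *v v) $ k)"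
    by (simp add: eq norm_mult)
  also have "\<dots> \<le> (\<Sum>j\<in>UNIV. norm (complex_of_real (M $ k $ j) * v $ j))"
    unfolding matrix_vector_mult_def by (simp add: norm_sum)
  also have "\<dots> \<le> (\<Sum>j\<in>UNIV. \<bar>M $ k $ j\<bar> * norm (v $ k))"
    by (intro sum_mono) (simp add: norm_mult mult_left_mono k)
  also have "\<dots> = (\<Sum>j\<in>UNIV. \<bar>M $ k $ j\<bar>) * norm (v $ k)"
    by (simp add: sum_distrib_right)
  also have "\<dots> \<le> (\<Sum>i\<in>UNIV. \<Sum>j\<in>UNIV. \<bar>M $ i $ j\<bar>) * norm (v $ k)"
    by (intro mult_right_mono member_le_sum) (auto intro: sum_nonneg)
  finally show ?thesis using pos by simp
qed

lemma tendsto_poly_char_polynomial: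
  fixes M :: "nat \<Rightarrow> real ^ 'n ^ 'n"
  assumes "M \<longlonglongrightarrow> L"
  shows "(\<lambda>k. poly (char_polynomial (M k)) z) \<longlonglongrightarrow> poly (char_polynomial L) z"
  unfolding poly_char_polynomial det_def vector_minus_component nth_map_matrix
  by (intro tendsto_intros assms)

text \<open>
  Root vectors of the \<open>M k\<close> are bounded, so along a subsequence they converge to a
  vector \<open>w\<close>. The characteristic polynomials converge pointwise, so \<open>w\<close> is a
  root vector of \<open>L\<close>. No coordinate of \<open>w\<close> lies on the imaginary axis, so
  each root is eventually on the same side of the axis as its limit. One index with the same
  count suffices to see below that the level sets of the count along a path are closed.
\<close>

lemma num_stable_limit:
  fixes M :: "nat \<Rightarrow> real ^ 'n ^ 'n"
  assumes lim: "M \<longlonglongrightarrow> L" and hyp: "\<And>z. is_eigenvalue L z \<Longrightarrow> Re z \<noteq> 0"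
  shows "\<exists>k. num_stable (M k) = num_stable L"
proof -
  have "\<forall>k. \<exists>r :: complex ^ 'n. char_polynomial (M k) = (\<Prod>i\<in>UNIV. [:- (r $ i), 1:])"
    using char_polynomial_roots_vec by blast
  then obtain r :: "nat \<Rightarrow> complex ^ 'n"
    where r: "\<And>k. char_polynomial (M k) = (\<Prod>i\<in>UNIV. [:- (r k $ i), 1:])"
    by metis
  have "(\<lambda>k. \<Sum>i\<in>UNIV. \<Sum>j\<in>UNIV. \<bar>M k $ i $ j\<bar>) \<longlonglongrightarrow> (\<Sum>i\<in>UNIV. \<Sum>j\<in>UNIV. \<bar>L $ i $ j\<bar>)"
    by (intro tendsto_intros lim)
  then have "Bseq (\<lambda>k. \<Sum>i\<in>UNIV. \<Sum>j\<in>UNIV. \<bar>M k $ i $ j\<bar>)"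
    by (rule convergent_imp_Bseq[OF convergentI])
  then obtain K where K: "\<And>k. (\<Sum>i\<in>UNIV. \<Sum>j\<in>UNIV. \<bar>M k $ i $ j\<bar>) \<le> K"
    unfolding Bseq_def by (metis abs_le_D1 real_norm_def)
  have "norm (r k) \<le> CARD('n) * K" for k
  proof -
    have "norm (r k $ i) \<le> K" for i
    proof -
      have "is_eigenvalue (M k) (r k $ i)"
        by (auto simp: is_eigenvalue_iff_root r poly_prod)
      then show ?thesis using eigenvalue_norm_le K order_trans by blast
    qed
    then have "(\<Sum>i\<in>UNIV. norm (r k $ i)) \<le> of_nat CARD('n) * K"
      by (intro sum_bounded_above) auto
    then show ?thesis
      using L2_set_le_sum[of UNIV "\<lambda>i. norm (r k $ i)"]
      by (simp add: norm_vec_def)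
  qed
  then have "bounded (range r)" by (auto simp: bounded_iff)
  then obtain w s where s: "strict_mono s" and w: "(r \<circ> s) \<longlonglongrightarrow> w"
    using bounded_imp_convergent_subsequence[of r] by blast
  have wi: "(\<lambda>k. r (s k) $ i) \<longlonglongrightarrow> w $ i" for i
    using tendsto_vec_nth[OF w] by (simp add: o_def)
  have "poly (char_polynomial L) x = (\<Prod>i\<in>UNIV. x - w $ i)" for x
  proof (rule LIMSEQ_unique)
    show "(\<lambda>k. poly (char_polynomial (M (s k))) x) \<longlonglongrightarrow> poly (char_polynomial L) x"
      using LIMSEQ_subseq_LIMSEQ[OF tendsto_poly_char_polynomial[OF lim] s] by (simp add: o_def)
    show "(\<lambda>k. poly (char_polynomial (M (s k))) x) \<longlonglongrightarrow> (\<Prod>i\<in>UNIV. x - w $ i)"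
      unfolding r by (simp add: poly_prod) (intro tendsto_intros wi)
  qed
  then have charL: "char_polynomial L = (\<Prod>i\<in>UNIV. [:- (w $ i), 1:])"
    by (simp add: poly_eq_poly_eq_iff[symmetric] fun_eq_iff poly_prod)
  have side: "\<forall>\<^sub>F k in sequentially. Re (r (s k) $ i) < 0 \<longleftrightarrow> Re (w $ i) < 0" for i
  proof -
    have re: "(\<lambda>k. Re (r (s k) $ i)) \<longlonglongrightarrow> Re (w $ i)"
      by (intro tendsto_intros wi)
    have "is_eigenvalue L (w $ i)"
      by (auto simp: is_eigenvalue_iff_root charL poly_prod)
    then consider "Re (w $ i) < 0" | "Re (w $ i) > 0"
      using hyp by (meson linorder_neqE_linordered_idom)
    then show ?thesis
    proof cases
      case 1
      then show ?thesis using order_tendstoD(2)[OF re 1] by (auto elim: eventually_mono)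
    next
      case 2
      then show ?thesis using order_tendstoD(1)[OF re 2] by (auto elim: eventually_mono)
    qed
  qed
  have "\<forall>\<^sub>F k in sequentially. \<forall>i. Re (r (s k) $ i) < 0 \<longleftrightarrow> Re (w $ i) < 0"
    using side by (rule eventually_all_finite)
  then obtain k where "\<And>i. Re (r (s k) $ i) < 0 \<longleftrightarrow> Re (w $ i) < 0"
    by (auto simp: eventually_sequentially)
  then have "num_stable (M (s k)) = num_stable L"
    by (simp add: num_stable_roots_vec[OF r] num_stable_roots_vec[OF charL])
  then show ?thesis ..
qed

text \<open>
  By the previous lemma, the parameters at which the count equals its initial value form a
  closed set, and so do those at which it differs. Since \<open>[0, 1]\<close> is connected, the second
  set is empty.
\<close>

lemma num_stable_homotopy:
  fixes M :: "real \<Rightarrow> real ^ 'n ^ 'n"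
  assumes cont: "continuous_on {0..1} M"
    and hyp: "\<And>t z. t \<in> {0..1} \<Longrightarrow> is_eigenvalue (M t) z \<Longrightarrow> Re z \<noteq> 0"
  shows "num_stable (M 0) = num_stable (M 1)"
proof -
  have closed: "closed {t \<in> {0..1}. Q (num_stable (M t))}" for Q
    unfolding closed_sequential_limits
  proof (intro allI impI, elim conjE)
    fix t l assume t: "\<forall>k. t k \<in> {t \<in> {0..1}. Q (num_stable (M t))}" and lim: "t \<longlonglongrightarrow> l"
    then have l: "l \<in> {0..1}"
      using closed_sequentially[of "{0..1::real}" t l] by auto
    have "(\<lambda>k. M (t k)) \<longlonglongrightarrow> M l"
      using cont t l lim unfolding continuous_on_sequentially comp_def by blast
    from num_stable_limit[OF this hyp[OF l]] obtain k
      where "num_stable (M (t k)) = num_stable (M l)" by blast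
    then show "l \<in> {t \<in> {0..1}. Q (num_stable (M t))}"
      using t l by (metis (mono_tags, lifting) mem_Collect_eq)
  qed
  let ?same = "{t \<in> {0..1}. num_stable (M t) = num_stable (M 0)}"
  let ?diff = "{t \<in> {0..1}. num_stable (M t) \<noteq> num_stable (M 0)}"
  have "connected {0..1::real}" by simp
  moreover have "closed ?same" "closed ?diff" by (rule closed)+
  moreover have "{0..1} \<subseteq> ?same \<union> ?diff" "?same \<inter> ?diff \<inter> {0..1} = {}" by auto
  moreover have "0 \<in> ?same \<inter> {0..1}" by simp
  ultimately have "?diff \<inter> {0..1} = {}"
    unfolding connected_closed by blast
  then have "1 \<notin> ?diff \<inter> {0..1}" by simp
  then show ?thesis by auto
qed

section \<open>Determinants of block matrices\<close>

definition block_matrix ::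
  "'a ^ 'm ^ 'm \<Rightarrow> 'a ^ 'n ^ 'm \<Rightarrow> 'a ^ 'm ^ 'n \<Rightarrow> 'a ^ 'n ^ 'n \<Rightarrow> 'a ^ ('m + 'n) ^ ('m + 'n)" where
  "block_matrix A B C D =
     (\<chi> i j. case i of
         Inl i' \<Rightarrow> (case j of Inl j' \<Rightarrow> A $ i' $ j' | Inr j' \<Rightarrow> B $ i' $ j')
       | Inr i' \<Rightarrow> (case j of Inl j' \<Rightarrow> C $ i' $ j' | Inr j' \<Rightarrow> D $ i' $ j'))"

lemma block_matrix_nth [simp]:
  "block_matrix A B C D $ Inl i $ Inl j = A $ i $ j"
  "block_matrix A B C D $ Inl i $ Inr j' = B $ i $ j'"
  "block_matrix A B C D $ Inr i' $ Inl j = C $ i' $ j"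
  "block_matrix A B C D $ Inr i' $ Inr j' = D $ i' $ j'"
  by (simp_all add: block_matrix_def)

lemma forall_sum_type: "(\<forall>x. P x) \<longleftrightarrow> (\<forall>i. P (Inl i)) \<and> (\<forall>i. P (Inr i))"
  by (metis sum.exhaust)

lemma sum_UNIV_Plus:
  fixes f :: "'m::finite + 'n::finite \<Rightarrow> 'a::comm_monoid_add"
  shows "(\<Sum>x\<in>UNIV. f x) = (\<Sum>i\<in>UNIV. f (Inl i)) + (\<Sum>j\<in>UNIV. f (Inr j))"
  unfolding UNIV_Plus_UNIV[symmetric] by (subst sum.Plus) (simp_all add: o_def)

lemma prod_UNIV_Plus:
  fixes f :: "'m::finite + 'n::finite \<Rightarrow> 'a::comm_monoid_mult"
  shows "(\<Prod>x\<in>UNIV. f x) = (\<Prod>i\<in>UNIV. f (Inl i)) * (\<Prod>j\<in>UNIV. f (Inr j))"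
  unfolding UNIV_Plus_UNIV[symmetric] by (subst prod.Plus) (simp_all add: o_def)

lemma block_matrix_mult:
  fixes A :: "'a::comm_ring_1 ^ 'm ^ 'm" and D :: "'a ^ 'n ^ 'n"
  shows "block_matrix A B C D ** block_matrix A' B' C' D' =
     block_matrix (A ** A' + B ** C') (A ** B' + B ** D') (C ** A' + D ** C') (C ** B' + D ** D')"
  by (simp add: vec_eq_iff forall_sum_type matrix_matrix_mult_def sum_UNIV_Plus)

text \<open>
  A permutation contributes to the Leibniz expansion only if it fixes every \<open>Inl i\<close>. Such
  permutations are the images, with the same sign, of the permutations of the second index type.
\<close>

lemma det_block_lower:
  fixes C :: "'a::comm_ring_1 ^ 'm ^ 'n" and S :: "'a ^ 'n ^ 'n"
  shows "det (block_matrix (mat 1) 0 C S) = det S"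
proof -
  let ?M = "block_matrix (mat 1) 0 C S"
  let ?f = "\<lambda>p. of_int (sign p) * (\<Prod>i\<in>UNIV. ?M $ i $ p i)"
  let ?R = "range (Inr :: 'n \<Rightarrow> 'm + 'n)"
  let ?h = "map_permutation UNIV (Inr :: 'n \<Rightarrow> 'm + 'n)"
  let ?g = "map_permutation ?R (inv (Inr :: 'n \<Rightarrow> 'm + 'n))"
  have inj: "inj (Inr :: 'n \<Rightarrow> 'm + 'n)" by simp
  have bij: "bij_betw (Inr :: 'n \<Rightarrow> 'm + 'n) UNIV ?R"
    using inj by (simp add: bij_betw_def)
  have bij': "bij_betw (inv (Inr :: 'n \<Rightarrow> 'm + 'n)) ?R UNIV"
    by (rule bij_betw_inv_into[OF bij])
  have zero: "?f p = 0" if "p permutes UNIV" "\<not> p permutes ?R" for p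
  proof -
    have "\<exists>i. p (Inl i) \<noteq> Inl i"
    proof (rule ccontr)
      assume "\<not> ?thesis"
      then have "p x = x" if "x \<notin> ?R" for x using that by (cases x) auto
      then have "p permutes ?R"
        using that(1) by (auto simp: permutes_def)
      with that(2) show False by contradiction
    qed
    then obtain i where i: "p (Inl i) \<noteq> Inl i" ..
    then have "?M $ Inl i $ p (Inl i) = 0"
      by (cases "p (Inl i)") (auto simp: mat_def)
    then show ?thesis by (metis UNIV_I finite mult_zero_right prod_zero)
  qed
  have "det ?M = (\<Sum>p | p permutes ?R. ?f p)"
    unfolding det_def
    by (rule sum.mono_neutral_right) (use zero in \<open>auto simp: finite_permutations intro: permutes_subset\<close>)
  also have "\<dots> = (\<Sum>q | q permutes UNIV. ?f (?h q))"
  proof (rule sum.reindex_bij_witness[of _ ?h ?g])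
    fix p assume "p \<in> {p. p permutes ?R}"
    then show "?h (?g p) = p" "?g p \<in> {p. p permutes UNIV}"
      using map_permutation_compose_inv[OF bij', of p Inr] map_permutation_permutes[OF bij', of p]
      by (auto simp: f_inv_into_f)
    then show "?f (?h (?g p)) = ?f p" by simp
  next
    fix q :: "'n \<Rightarrow> 'n" assume "q \<in> {p. p permutes UNIV}"
    then show "?g (?h q) = q" "?h q \<in> {p. p permutes ?R}"
      using map_permutation_compose_inv[OF bij, of q "inv Inr"] map_permutation_permutes[OF bij, of q]
      by auto
  qed
  also have "\<dots> = det S"
    unfolding det_def
  proof (rule sum.cong[OF refl])
    fix q :: "'n \<Rightarrow> 'n" assume "q \<in> {p. p permutes UNIV}"
    then have q: "q permutes UNIV" by simp
    have "?h q permutes ?R" using map_permutation_permutes[OF bij q] .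
    then have l: "?h q (Inl i) = Inl i" for i by (auto simp: permutes_def)
    have r: "?h q (Inr j) = Inr (q j)" for j by (simp add: map_permutation_apply)
    show "?f (?h q) = of_int (sign q) * (\<Prod>i\<in>UNIV. S $ i $ q i)"
      using sign_map_permutation[OF inj q] by (simp add: prod_UNIV_Plus l r mat_def)
  qed
  finally show ?thesis .
qed

lemma det_block_upper_unipotent:
  fixes B :: "'a::comm_ring_1 ^ 'n ^ 'm"
  shows "det (block_matrix (mat 1) B 0 (mat 1)) = 1"
proof -
  have "transpose (block_matrix (mat 1) B 0 (mat 1)) = block_matrix (mat 1) 0 (transpose B) (mat 1)"
    by (simp add: vec_eq_iff forall_sum_type transpose_def mat_def)
  then show ?thesis by (metis det_block_lower det_I det_transpose)
qed

lemma mat_scalar_mult_left: "mat x ** A = (\<chi> i j. x * A $ i $ j)"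
  for A :: "'a::comm_ring_1 ^ 'n ^ 'n"
  by (simp add: vec_eq_iff matrix_matrix_mult_def mat_def if_distrib[of "\<lambda>x. x * _"] cong: if_cong)

text \<open>
  Adding \<open>z - 1\<close> times the second block column to the first turns the upper left block into
  the identity; adding the first block column to the second then clears the upper right block,
  and leaves \<open>J + q z\<close> in the lower right. No inverse is used, so the identity also
  covers \<open>z = 0\<close>.
\<close>

lemma det_companion_block:
  fixes J :: "'a::comm_ring_1 ^ 'n ^ 'n"
  shows "det (block_matrix (mat z) (- mat 1) J (mat q)) = det (J + mat (q * z))"
proof -
  let ?L = "block_matrix (mat 1) 0 (mat (z - 1)) (mat 1) :: 'a ^ ('n + 'n) ^ ('n + 'n)"
  let ?U = "block_matrix (mat 1) (mat 1) 0 (mat 1) :: 'a ^ ('n + 'n) ^ ('n + 'n)"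
  let ?M = "block_matrix (mat z) (- mat 1) J (mat q)"
  have scal: "mat x ** mat y = (mat (x * y) :: 'a ^ 'n ^ 'n)" for x y
    unfolding mat_scalar_mult_left by (simp add: vec_eq_iff mat_def)
  have neg: "(- mat 1) ** X = - X" for X :: "'a ^ 'n ^ 'n"
    by (simp add: vec_eq_iff matrix_matrix_mult_def mat_def if_distrib[of "\<lambda>x. x * _"]
        sum_negf cong: if_cong)
  have "(?M ** ?L) ** ?U
          = block_matrix (mat 1) 0 (J + mat (q * (z - 1))) (J + mat (q * z))"
    unfolding block_matrix_mult
    by (simp add: scal neg, simp add: vec_eq_iff mat_def forall_sum_type algebra_simps)
  then have "det ((?M ** ?L) ** ?U) = det (J + mat (q * z))"
    by (simp add: det_block_lower)
  then show ?thesis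
    by (simp add: det_mul det_block_lower det_block_upper_unipotent)
qed

section \<open>Inertia of damped second-order systems\<close>

text \<open>
  The first-order form of \<open>a\<^sub>j'' / e\<^sub>j + c a\<^sub>j' + (J a)\<^sub>j = 0\<close> in the variables \<open>(a, a')\<close>: an
  oscillator with stiffness \<open>J\<close>, damping \<open>c\<close> and masses \<open>1 / e\<^sub>j\<close>.
\<close>

definition second_order_matrix :: "real \<Rightarrow> ('n \<Rightarrow> real) \<Rightarrow> real ^ 'n ^ 'n \<Rightarrow> real ^ ('n + 'n) ^ ('n + 'n)" where
  "second_order_matrix c e J =
     block_matrix 0 (mat 1) (\<chi> i j. - (e i * J $ i $ j)) (\<chi> i j. if i = j then - (c * e i) else 0)"

text \<open>
  A real symmetric matrix is Hermitian, so its form takes real values also at complex vectors.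
\<close>

lemma hermitian_form_real:
  fixes J :: "real ^ 'n ^ 'n"
  assumes "transpose J = J"
  shows "Im (\<Sum>i\<in>UNIV. cnj (v $ i) * (map_matrix complex_of_real J *v v) $ i) = 0"
proof -
  let ?q = "\<Sum>i\<in>UNIV. cnj (v $ i) * (map_matrix complex_of_real J *v v) $ i"
  have sym: "J $ i $ j = J $ j $ i" for i j
    using assms by (metis transpose_def vec_lambda_beta)
  have q: "?q = (\<Sum>i\<in>UNIV. \<Sum>j\<in>UNIV. cnj (v $ i) * (J $ i $ j) * v $ j)"
    by (simp add: matrix_vector_mult_def sum_distrib_left mult.assoc)
  have "cnj ?q = (\<Sum>i\<in>UNIV. \<Sum>j\<in>UNIV. v $ i * (J $ i $ j) * cnj (v $ j))"
    unfolding q by simp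
  also have "\<dots> = (\<Sum>j\<in>UNIV. \<Sum>i\<in>UNIV. v $ i * (J $ i $ j) * cnj (v $ j))"
    by (rule sum.swap)
  also have "\<dots> = ?q"
    unfolding q by (intro sum.cong refl) (simp add: sym mult_ac)
  finally show ?thesis by (metis Reals_cnj_iff complex_is_Real_iff)
qed

lemma sum_norm_square_pos:
  fixes v :: "complex ^ 'n"
  assumes "v \<noteq> 0"
  shows "(\<Sum>i\<in>UNIV. (norm (v $ i))\<^sup>2) > 0"
proof -
  obtain k where "v $ k \<noteq> 0" using assms by (auto simp: vec_eq_iff)
  then show ?thesis by (intro sum_pos2[of _ k]) auto
qed

lemma eigenvalue_symmetric_real:
  assumes "transpose J = J" "is_eigenvalue J z"
  shows "Im z = 0"
proof -
  from assms(2) obtain v where v: "v \<noteq> 0" "map_matrix complex_of_real J *v v = z *s v"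
    unfolding is_eigenvalue_def by blast
  have "(\<Sum>i\<in>UNIV. cnj (v $ i) * (map_matrix complex_of_real J *v v) $ i)
          = z * of_real (\<Sum>i\<in>UNIV. (norm (v $ i))\<^sup>2)"
    unfolding v(2) by (simp add: sum_distrib_left complex_norm_square mult_ac del: of_real_power)
  then have "Im z * (\<Sum>i\<in>UNIV. (norm (v $ i))\<^sup>2) = 0"
    using hermitian_form_real[OF assms(1), of v] by simp
  then show ?thesis using sum_norm_square_pos[OF v(1)] by simp
qed

text \<open>
  An eigenvector has the form \<open>(a, z a)\<close> with
  \<open>z\<^sup>2 a\<^sub>j / e\<^sub>j + c z a\<^sub>j + (J a)\<^sub>j = 0\<close>. Pairing with \<open>a\<close> gives a
  scalar quadratic equation for \<open>z\<close>. If \<open>z\<close> were imaginary, its imaginary part would be the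
  damping term alone, so \<open>z = 0\<close> and \<open>J\<close> would be singular.
\<close>

lemma second_order_not_imaginary:
  fixes J :: "real ^ 'n ^ 'n"
  assumes J: "transpose J = J" "\<not> is_eigenvalue J 0"
    and c: "c > 0" and e: "\<And>i. e i > 0"
    and eig: "is_eigenvalue (second_order_matrix c e J) z"
  shows "Re z \<noteq> 0"
proof
  assume z: "Re z = 0"
  from eig obtain u where u: "u \<noteq> 0"
    and eq: "map_matrix complex_of_real (second_order_matrix c e J) *v u = z *s u"
    unfolding is_eigenvalue_def by blast
  define a b :: "complex ^ 'n" where "a = (\<chi> i. u $ Inl i)" and "b = (\<chi> i. u $ Inr i)"
  let ?Ja = "map_matrix complex_of_real J *v a"
  have eql: "b $ i = z * a $ i" for i
    using arg_cong[OF eq, of "\<lambda>w. w $ Inl i"]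
    by (simp add: matrix_vector_mult_def second_order_matrix_def sum_UNIV_Plus a_def b_def mat_def
        if_distrib[of complex_of_real] if_distrib[of "\<lambda>x. x * _"] cong: if_cong)
  have eqr: "- (e i * ?Ja $ i) - c * e i * b $ i = z * b $ i" for i
    using arg_cong[OF eq, of "\<lambda>w. w $ Inr i"]
    by (simp add: matrix_vector_mult_def second_order_matrix_def sum_UNIV_Plus a_def b_def
        if_distrib[of complex_of_real] if_distrib[of "\<lambda>x. x * _"] sum_distrib_left sum_negf mult.assoc
        cong: if_cong)
  have pencil: "?Ja $ i = - (z\<^sup>2 / e i + c * z) * a $ i" for i
  proof -
    have "- (e i * ?Ja $ i) = (z\<^sup>2 + c * e i * z) * a $ i"
      using eqr[of i] unfolding eql by (simp add: algebra_simps power2_eq_square)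
    then have "e i * ?Ja $ i = - ((z\<^sup>2 + c * e i * z) * a $ i)"
      by (metis minus_minus)
    also have "\<dots> = e i * (- (z\<^sup>2 / e i + c * z) * a $ i)"
      using e[of i] by (simp add: algebra_simps)
    finally show ?thesis
      using e[of i] by (metis mult_left_cancel of_real_eq_0_iff order_less_irrefl)
  qed
  have a: "a \<noteq> 0"
  proof
    assume a: "a = 0"
    then have "b = 0" using eql by (simp add: vec_eq_iff)
    with a have "u = 0" by (simp add: vec_eq_iff forall_sum_type a_def b_def)
    with u show False by contradiction
  qed
  \<comment> \<open>Since \<open>z\<^sup>2\<close> is real, only the damping term contributes to the imaginary part of the
    Hermitian form of \<open>J\<close> at \<open>a\<close>.\<close>
  have "Im (cnj (a $ i) * ?Ja $ i) = - (c * Im z) * (norm (a $ i))\<^sup>2" for i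
  proof -
    have "cnj (a $ i) * ?Ja $ i = - (z\<^sup>2 / e i + c * z) * of_real ((norm (a $ i))\<^sup>2)"
      unfolding pencil by (simp add: complex_norm_square mult_ac del: of_real_power)
    then show ?thesis using z by (simp add: power2_eq_square)
  qed
  then have "c * Im z * (\<Sum>i\<in>UNIV. (norm (a $ i))\<^sup>2) = 0"
    using hermitian_form_real[OF J(1), of a] by (simp add: sum_distrib_left sum_negf)
  then have "z = 0"
    using sum_norm_square_pos[OF a] c z by (simp add: complex_eq_iff)
  then have "?Ja = 0 *s a" by (simp add: vec_eq_iff pencil)
  then have "is_eigenvalue J 0" using a unfolding is_eigenvalue_def by blast
  with J(2) show False by contradiction
qed

text \<open>
  The two roots have sum \<open>-c < 0\<close> and product \<open>\<mu>\<close>: for \<open>\<mu> < 0\<close> they are real of opposite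
  signs, for \<open>\<mu> > 0\<close> they are either conjugate or real of equal sign, with negative real parts.
\<close>

lemma num_stable_quadratic:
  fixes c \<mu> :: real
  assumes c: "c > 0" and \<mu>: "\<mu> \<noteq> 0"
  shows "size {#z \<in># proots [:complex_of_real \<mu>, complex_of_real c, 1:]. Re z < 0#}
           = (if \<mu> > 0 then 2 else 1)"
proof -
  let ?p = "[:complex_of_real \<mu>, complex_of_real c, 1:]"
  have monic: "degree ?p = 2" "coeff ?p 2 = 1" by (simp_all add: numeral_2_eq_2)
  obtain root :: "nat \<Rightarrow> complex" where root: "(\<Prod>i<2. [:- root i, 1:]) = ?p"
    by (rule complex_poly_decompose'[of ?p]) (simp only: monic smult_1_left)
  define r s where "r = root 0" and "s = root 1"
  have fac: "?p = [:- r, 1:] * [:- s, 1:]"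
    using root[symmetric] by (simp only: r_def s_def numeral_2_eq_2 prod.lessThan_Suc lessThan_0 prod.empty mult_1 One_nat_def)
  have "?p = [:r * s, - (r + s), 1:]"
    unfolding fac by simp
  then have vieta: "r + s = - of_real c" "r * s = of_real \<mu>"
    by (simp_all add: eq_neg_iff_add_eq_0)
  have count: "proots ?p = {#r, s#}"
    unfolding fac by (subst proots_mult) simp_all
  have re: "Re r + Re s = - c" and im: "Im s = - Im r"
    using vieta(1) by (simp_all add: complex_eq_iff)
  have prod: "Re r * Re s + (Im r)\<^sup>2 = \<mu>" and cross: "Im r * (Re s - Re r) = 0"
  proof -
    show "Re r * Re s + (Im r)\<^sup>2 = \<mu>"
      using arg_cong[OF vieta(2), of Re] im by (simp add: power2_eq_square)
    show "Im r * (Re s - Re r) = 0"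
      using arg_cong[OF vieta(2), of Im] im by (simp add: algebra_simps)
  qed
  show ?thesis
  proof (cases "Im r = 0")
    case False
    then have eq: "Re s = Re r" using cross by simp
    then have "Re r < 0" using re c by simp
    moreover have "\<mu> > 0" unfolding prod[symmetric] eq using False by (simp add: add_nonneg_pos)
    ultimately show ?thesis by (simp add: count eq)
  next
    case True
    then have pr: "Re r * Re s = \<mu>" using prod by simp
    show ?thesis
    proof (cases "\<mu> > 0")
      case True
      then have "Re r < 0 \<and> Re s < 0"
        using pr re c zero_less_mult_iff[of "Re r" "Re s"] by linarith
      then show ?thesis using True by (simp add: count)
    next
      case False
      then have "Re r * Re s < 0" using pr \<mu> by simp
      then have "Re r < 0 \<and> Re s > 0 \<or> Re r > 0 \<and> Re s < 0"
        by (simp add: mult_less_0_iff disj_commute)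
      then show ?thesis using False by (auto simp: count)
    qed
  qed
qed

lemma det_uminus: "det (- X) = (- 1) ^ CARD('n) * det X"
  for X :: "'a::comm_ring_1 ^ 'n ^ 'n"
proof -
  have "- X = (\<chi> i. (- 1) *s (X $ i))" by (simp add: vec_eq_iff)
  then show ?thesis using det_rows_mul[of "\<lambda>_. - 1" "\<lambda>i. X $ i"] by simp
qed

text \<open>
  With unit coefficients the block determinant is the characteristic polynomial of \<open>J\<close> at
  \<open>-(z\<^sup>2 + c z)\<close>, up to the sign \<open>(-1)\<^sup>n\<close>: each root \<open>\<mu>\<close> of \<open>J\<close> contributes the factor
  \<open>z\<^sup>2 + c z + \<mu>\<close>, with multiplicities preserved.
\<close>

lemma char_polynomial_second_order:
  fixes J :: "real ^ 'n ^ 'n" and r :: "complex ^ 'n"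
  assumes "char_polynomial J = (\<Prod>i\<in>UNIV. [:- (r $ i), 1:])"
  shows "char_polynomial (second_order_matrix c (\<lambda>_. 1) J)
           = (\<Prod>i\<in>UNIV. [:r $ i, complex_of_real c, 1:])"
proof -
  have "poly (char_polynomial (second_order_matrix c (\<lambda>_. 1) J)) z
          = poly (\<Prod>i\<in>UNIV. [:r $ i, complex_of_real c, 1:]) z" for z
  proof -
    let ?J = "map_matrix complex_of_real J"
    let ?w = "(z + c) * z"
    have "mat z - map_matrix complex_of_real (second_order_matrix c (\<lambda>_. 1) J)
            = block_matrix (mat z) (- mat 1) ?J (mat (z + c))"
      by (simp add: vec_eq_iff forall_sum_type second_order_matrix_def mat_def)
    then have "poly (char_polynomial (second_order_matrix c (\<lambda>_. 1) J)) z = det (?J + mat ?w)"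
      by (simp add: poly_char_polynomial det_companion_block)
    also have "?J + mat ?w = - (mat (- ?w) - ?J)"
      by (simp add: vec_eq_iff mat_def)
    also have "det (- (mat (- ?w) - ?J)) = (- 1) ^ CARD('n) * poly (char_polynomial J) (- ?w)"
      by (simp only: det_uminus poly_char_polynomial)
    also have "\<dots> = (\<Prod>i\<in>UNIV. - 1 * (- ?w - r $ i))"
    proof -
      have lin: "poly [:- a, 1:] w = w - a" for a w :: complex by simp
      show ?thesis unfolding prod.distrib by (simp only: assms poly_prod lin prod_constant)
    qed
    also have "\<dots> = poly (\<Prod>i\<in>UNIV. [:r $ i, complex_of_real c, 1:]) z"
      by (simp add: poly_prod algebra_simps)
    finally show ?thesis .
  qed
  then show ?thesis by (simp add: poly_eq_poly_eq_iff[symmetric] fun_eq_iff)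
qed

text \<open>
  Each eigenvalue of \<open>J\<close> yields one stable root of its quadratic factor, and a second one
  exactly when it is positive.
\<close>

lemma num_stable_second_order_unit:
  fixes J :: "real ^ 'n ^ 'n"
  assumes J: "transpose J = J" "\<not> is_eigenvalue J 0" and c: "c > 0"
  shows "num_stable (second_order_matrix c (\<lambda>_. 1) J) = CARD('n) + num_unstable J"
proof -
  obtain r :: "complex ^ 'n" where r: "char_polynomial J = (\<Prod>i\<in>UNIV. [:- (r $ i), 1:])"
    by (rule char_polynomial_roots_vec)
  let ?q = "\<lambda>i. [:r $ i, complex_of_real c, 1:]"
  have count: "size {#z \<in># proots (?q i). Re z < 0#} = 1 + (if Re (r $ i) > 0 then 1 else 0)" for i
  proof -
    have eig: "is_eigenvalue J (r $ i)"
      by (auto simp: is_eigenvalue_iff_root r poly_prod)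
    then have real: "r $ i = of_real (Re (r $ i))"
      using eigenvalue_symmetric_real[OF J(1)] by (simp add: complex_eq_iff)
    moreover have "Re (r $ i) \<noteq> 0"
      using eig J(2) real by (metis of_real_0)
    ultimately show ?thesis
      using num_stable_quadratic[OF c, of "Re (r $ i)"] by simp
  qed
  have add: "size (filter_mset P (\<Sum>i\<in>I. f i)) = (\<Sum>i\<in>I. size (filter_mset P (f i)))"
    for P and f :: "'n \<Rightarrow> complex multiset" and I
    by (induction I rule: infinite_finite_induct) auto
  have "num_stable (second_order_matrix c (\<lambda>_. 1) J)
          = (\<Sum>i\<in>UNIV. size {#z \<in># proots (?q i). Re z < 0#})"
    unfolding num_stable_proots char_polynomial_second_order[OF r]
    by (subst proots_prod) (auto simp: add)
  also have "\<dots> = CARD('n) + card {i. Re (r $ i) > 0}"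
    unfolding count sum.distrib by (simp add: sum.If_cases)
  finally show ?thesis by (simp add: num_unstable_roots_vec[OF r])
qed

text \<open>
  Along the segment from \<open>e\<close> to the constant \<open>1\<close> the coefficients stay positive, so no
  eigenvalue meets the imaginary axis and the count is the one for unit coefficients.
\<close>

lemma num_stable_second_order:
  fixes J :: "real ^ 'n ^ 'n"
  assumes J: "transpose J = J" "\<not> is_eigenvalue J 0" and c: "c > 0" and e: "\<And>i. e i > 0"
  shows "num_stable (second_order_matrix c e J) = CARD('n) + num_unstable J"
proof -
  define E where "E t i = (1 - t) * e i + t" for t i
  have E: "E t i > 0" if "t \<in> {0..1}" for t i
  proof (cases "t = 1")
    case False
    then show ?thesis using that e[of i] unfolding E_def by (intro add_pos_nonneg) auto
  qed (simp add: E_def)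
  have "continuous_on {0..1} (\<lambda>t. second_order_matrix c (E t) J $ i $ j)" for i j
    by (cases i; cases j; cases "i = j") (auto simp: second_order_matrix_def E_def intro!: continuous_intros)
  then have "continuous_on {0..1} (\<lambda>t. \<chi> i j. second_order_matrix c (E t) J $ i $ j)"
    by (intro continuous_on_vec_lambda)
  then have cont: "continuous_on {0..1} (\<lambda>t. second_order_matrix c (E t) J)" by simp
  have "num_stable (second_order_matrix c (E 0) J) = num_stable (second_order_matrix c (E 1) J)"
    by (rule num_stable_homotopy[OF cont second_order_not_imaginary[OF J c E]])
  moreover have "E 0 = e" "E 1 = (\<lambda>_. 1)" by (auto simp: E_def)
  ultimately show ?thesis using num_stable_second_order_unit[OF J c] by simp
qed

text \<open>
  With no eigenvalue on the imaginary axis, the two counts add up to the dimension, both for the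
  oscillator and for \<open>J\<close>; so the unstable count follows from the stable one.
\<close>

lemma second_order_inertia:
  fixes J :: "real ^ 'n ^ 'n"
  assumes J: "transpose J = J" "\<not> is_eigenvalue J 0" and c: "c > 0" and e: "\<And>i. e i > 0"
  shows "num_stable (second_order_matrix c e J) = CARD('n) + num_unstable J"
    and "num_unstable (second_order_matrix c e J) = num_stable J"
proof -
  show stable: "num_stable (second_order_matrix c e J) = CARD('n) + num_unstable J"
    by (rule num_stable_second_order[OF assms])
  have "num_stable (second_order_matrix c e J) + num_unstable (second_order_matrix c e J)
          = CARD('n + 'n)"
    unfolding num_stable_add_num_unstable_iff
    using second_order_not_imaginary[where e = e, OF J c e] by blast
  moreover have "Re z \<noteq> 0" if "is_eigenvalue J z" for z
  proof
    assume "Re z = 0"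
    then have "z = 0" using eigenvalue_symmetric_real[OF J(1) that] by (simp add: complex_eq_iff)
    with that J(2) show False by simp
  qed
  then have "num_stable J + num_unstable J = CARD('n)"
    unfolding num_stable_add_num_unstable_iff by blast
  ultimately show "num_unstable (second_order_matrix c e J) = num_stable J"
    using stable by simp
qed

section \<open>The two linearisations\<close>

lemma has_derivative_vec_nthI:
  fixes f :: "'a::real_normed_vector \<Rightarrow> real ^ 'n"
  assumes "\<And>i. ((\<lambda>x. f x $ i) has_derivative (\<lambda>x. f' x $ i)) F"
  shows "(f has_derivative f') F"
proof -
  have sum: "((\<lambda>x. \<Sum>i\<in>UNIV. f x $ i *\<^sub>R (axis i 1 :: real ^ 'n)) has_derivative (\<lambda>x. \<Sum>i\<in>UNIV. f' x $ i *\<^sub>R axis i 1)) F"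
    by (intro has_derivative_sum has_derivative_scaleR_left assms)
  have expand: "(\<Sum>i\<in>UNIV. v $ i *\<^sub>R (axis i 1 :: real ^ 'n)) = v" for v :: "real ^ 'n"
    using basis_expansion[of v] by (simp add: scalar_mult_eq_scaleR)
  from sum show ?thesis by (simp only: expand)
qed

lemma linearisation_eqI:
  assumes "(F has_derivative (\<lambda>h. M *v h)) (at u)"
  shows "linearisation F u = M"
  unfolding linearisation_def jacobian_def frechet_derivative_at[OF assms, symmetric] by simp

definition landau_matrix :: "real \<Rightarrow> real \<Rightarrow> real \<Rightarrow> real \<Rightarrow> real ^ 3 \<Rightarrow> real ^ 3 ^ 3" where
  "landau_matrix \<mu>0 \<beta>2 K0 K2 A =
     (\<chi> j k. if k = j then \<mu>0 + 3 * K0 * (A $ j)\<^sup>2 + K2 * ((A $ (j + 1))\<^sup>2 + (A $ (j + 2))\<^sup>2)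
             else if k = j + 1 then \<beta>2 * A $ (j + 2) + 2 * K2 * A $ j * A $ (j + 1)
             else \<beta>2 * A $ (j + 1) + 2 * K2 * A $ j * A $ (j + 2))"

lemma index3_simps: "(1::3) + 1 = 2" "(1::3) + 2 = 3" "(2::3) + 1 = 3" "(2::3) + 2 = 1"
  "(3::3) + 1 = 1" "(3::3) + 2 = 2" "(1::3) \<noteq> 2" "(1::3) \<noteq> 3" "(2::3) \<noteq> 3"
  "(2::3) \<noteq> 1" "(3::3) \<noteq> 1" "(3::3) \<noteq> 2"
  by simp_all

text \<open>
  The symmetry on which everything rests: the Landau equations are a gradient system.
\<close>

lemma transpose_landau_matrix:
  "transpose (landau_matrix \<mu>0 \<beta>2 K0 K2 A) = landau_matrix \<mu>0 \<beta>2 K0 K2 A"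
  unfolding vec_eq_iff forall_3 transpose_def landau_matrix_def vec_lambda_beta index3_simps
  by (simp add: index3_simps)

lemma has_derivative_landau_field:
  "(landau_field \<mu>0 \<beta>2 K0 K2 has_derivative (\<lambda>h. landau_matrix \<mu>0 \<beta>2 K0 K2 A *v h)) (at A)"
proof (rule has_derivative_vec_nthI)
  fix i :: 3
  have wrap: "(4::3) = 1" "(5::3) = 2" by simp_all
  have row: "(landau_matrix \<mu>0 \<beta>2 K0 K2 A *v h) $ i
     = (\<mu>0 + 3 * K0 * (A $ i)\<^sup>2 + K2 * ((A $ (i + 1))\<^sup>2 + (A $ (i + 2))\<^sup>2)) * h $ i
       + (\<beta>2 * A $ (i + 2) + 2 * K2 * A $ i * A $ (i + 1)) * h $ (i + 1)
       + (\<beta>2 * A $ (i + 1) + 2 * K2 * A $ i * A $ (i + 2)) * h $ (i + 2)" for h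
    using exhaust_3[of i]
    by (elim disjE) (simp_all add: matrix_vector_mult_def sum_3 landau_matrix_def index3_simps wrap)
  have nth: "((\<lambda>x. x $ k) has_derivative (\<lambda>h. h $ k)) (at A)" for k :: 3
    by (rule bounded_linear_imp_has_derivative) (rule bounded_linear_vec_nth)
  show "((\<lambda>x. landau_field \<mu>0 \<beta>2 K0 K2 x $ i) has_derivative
          (\<lambda>h. (landau_matrix \<mu>0 \<beta>2 K0 K2 A *v h) $ i)) (at A)"
    unfolding landau_field_def vec_lambda_beta row power2_eq_square
    by (rule derivative_eq_intros nth | simp)+ (simp add: fun_eq_iff algebra_simps)
qed

lemma linearisation_landau_field:
  "linearisation (landau_field \<mu>0 \<beta>2 K0 K2) A = landau_matrix \<mu>0 \<beta>2 K0 K2 A"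
  by (rule linearisation_eqI[OF has_derivative_landau_field])

text \<open>
  The Landau field is the only nonlinear part of the spatial dynamics, so its derivative
  determines that of the whole field by the chain rule.
\<close>

lemma spatial_field_eq:
  "spatial_field \<theta> c0 \<mu>0 \<beta>2 K0 K2 u =
     phase_point (B_part u)
       (\<chi> j. (1 / (4 * (dir \<theta> \<bullet> wavevec j)\<^sup>2))
              * (- landau_field \<mu>0 \<beta>2 K0 K2 (A_part u) $ j - c0 * B_part u $ j))"
  unfolding spatial_field_def Let_def
  by (rule arg_cong[where f = "phase_point _"])
     (simp add: vec_eq_iff landau_field_def diff_divide_distrib add_divide_distrib algebra_simps)

lemma linearisation_spatial_field:
  "linearisation (spatial_field \<theta> c0 \<mu>0 \<beta>2 K0 K2) (phase_point A B)
     = second_order_matrix c0 (\<lambda>j. 1 / (4 * (dir \<theta> \<bullet> wavevec j)\<^sup>2)) (landau_matrix \<mu>0 \<beta>2 K0 K2 A)"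
    (is "_ = second_order_matrix c0 ?e ?J")
proof (rule linearisation_eqI, rule has_derivative_vec_nthI)
  let ?u = "phase_point A B"
  have nth: "((\<lambda>x. x $ k) has_derivative (\<lambda>h. h $ k)) (at v)" for k :: "3 + 3" and v :: "real ^ (3 + 3)"
    by (rule bounded_linear_imp_has_derivative) (rule bounded_linear_vec_nth)
  have A_part: "(A_part has_derivative A_part) (at ?u)"
    by (rule has_derivative_vec_nthI) (simp add: A_part_def nth)
  have "A_part ?u = A" by (simp add: A_part_def phase_point_def vec_eq_iff)
  then have "(landau_field \<mu>0 \<beta>2 K0 K2 has_derivative (\<lambda>h. ?J *v h)) (at (A_part ?u))"
    using has_derivative_landau_field by simp
  from has_derivative_compose[OF A_part this]
  have lan: "((\<lambda>x. landau_field \<mu>0 \<beta>2 K0 K2 (A_part x)) has_derivative (\<lambda>h. ?J *v A_part h)) (at ?u)" .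
  have lani: "((\<lambda>x. landau_field \<mu>0 \<beta>2 K0 K2 (A_part x) $ j) has_derivative (\<lambda>h. (?J *v A_part h) $ j)) (at ?u)" for j
    by (rule has_derivative_compose[OF lan bounded_linear_imp_has_derivative[OF bounded_linear_vec_nth]])
  fix i :: "3 + 3"
  show "((\<lambda>x. spatial_field \<theta> c0 \<mu>0 \<beta>2 K0 K2 x $ i) has_derivative
          (\<lambda>h. (second_order_matrix c0 ?e ?J *v h) $ i)) (at ?u)"
  proof (cases i)
    case (Inl j)
    have "(second_order_matrix c0 ?e ?J *v h) $ i = h $ Inr j" for h
      by (simp add: Inl matrix_vector_mult_def second_order_matrix_def sum_UNIV_Plus mat_def
          if_distrib[of "\<lambda>x. x * _"] cong: if_cong)
    then show ?thesis
      by (simp add: spatial_field_eq phase_point_def Inl B_part_def nth)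
  next
    case (Inr j)
    have "(second_order_matrix c0 ?e ?J *v h) $ i
            = ?e j * (- (?J *v A_part h) $ j - c0 * h $ Inr j)" for h
      by (simp add: Inr matrix_vector_mult_def second_order_matrix_def sum_UNIV_Plus A_part_def
          if_distrib[of "\<lambda>x. x * _"] sum_distrib_left sum_negf sum_divide_distrib diff_divide_distrib
          cong: if_cong)
    moreover have "((\<lambda>x. ?e j * (- landau_field \<mu>0 \<beta>2 K0 K2 (A_part x) $ j - c0 * x $ Inr j))
        has_derivative (\<lambda>h. ?e j * (- (?J *v A_part h) $ j - c0 * h $ Inr j))) (at ?u)"
      by (intro derivative_intros lani nth)
    ultimately show ?thesis
      by (simp add: spatial_field_eq phase_point_def Inr B_part_def)
  qed
qed

text \<open>
  The second wave vector is the critical one: \<open>2 d \<bullet> k\<^sub>2 = -2 cos (\<theta> + \<pi>/3)\<close>, which vanishes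
  only once \<open>\<theta>\<close> reaches \<open>\<pi>/6\<close>.
\<close>

lemma dir_wavevec_nonzero:
  assumes "0 < \<theta>" "\<theta> < pi / 6"
  shows "dir \<theta> \<bullet> wavevec j \<noteq> 0"
proof -
  have "cos \<theta> > 0" "sin \<theta> > 0"
    using assms by (auto intro!: cos_gt_zero_pi sin_gt_zero)
  moreover have "cos (\<theta> + pi / 3) > 0"
    using assms by (intro cos_gt_zero_pi) auto
  then have "cos \<theta> - sqrt 3 * sin \<theta> > 0"
    by (simp add: cos_add cos_60 sin_60 algebra_simps)
  moreover have "sqrt 3 * sin \<theta> > 0" using \<open>sin \<theta> > 0\<close> by simp
  ultimately have "cos \<theta> \<noteq> 0" "- cos \<theta> + sqrt 3 * sin \<theta> \<noteq> 0" "cos \<theta> + sqrt 3 * sin \<theta> \<noteq> 0"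
    by linarith+
  then show ?thesis
    by (auto simp: dir_def wavevec_def inner_vec_def sum_2 algebra_simps)
qed

theorem lemma4p4:
  fixes \<theta> c0 \<mu>0 \<beta>2 K0 K2 :: real and A :: "real ^ 3"
  assumes "0 < \<theta>" and "\<theta> < pi / 6" and "c0 > 0"
    and "is_equilibrium (spatial_field \<theta> c0 \<mu>0 \<beta>2 K0 K2) (phase_point A 0)"
  shows "(\<forall>n\<le>3.
            num_unstable (linearisation (landau_field \<mu>0 \<beta>2 K0 K2) A) = n \<and>
            num_stable (linearisation (landau_field \<mu>0 \<beta>2 K0 K2) A) = 3 - n \<longrightarrow>
            num_stable (linearisation (spatial_field \<theta> c0 \<mu>0 \<beta>2 K0 K2) (phase_point A 0)) = 3 + n \<and>
            num_unstable (linearisation (spatial_field \<theta> c0 \<mu>0 \<beta>2 K0 K2) (phase_point A 0)) = 3 - n)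
       \<and> (pde_stable \<mu>0 \<beta>2 K0 K2 A \<longrightarrow>
            num_stable (linearisation (spatial_field \<theta> c0 \<mu>0 \<beta>2 K0 K2) (phase_point A 0)) = 3 \<and>
            num_unstable (linearisation (spatial_field \<theta> c0 \<mu>0 \<beta>2 K0 K2) (phase_point A 0)) = 3)"
proof -
  let ?J = "linearisation (landau_field \<mu>0 \<beta>2 K0 K2) A"
  let ?L = "linearisation (spatial_field \<theta> c0 \<mu>0 \<beta>2 K0 K2) (phase_point A 0)"
  have inertia: "num_stable ?L = 3 + num_unstable ?J \<and> num_unstable ?L = num_stable ?J"
    if "num_stable ?J + num_unstable ?J = 3"
  proof -
    have "Re z \<noteq> 0" if "is_eigenvalue ?J z" for z
      using \<open>num_stable ?J + num_unstable ?J = 3\<close> num_stable_add_num_unstable_iff[of ?J] that by simp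
    then have "\<not> is_eigenvalue ?J 0" by fastforce
    moreover have "1 / (4 * (dir \<theta> \<bullet> wavevec j)\<^sup>2) > 0" for j
      using dir_wavevec_nonzero[OF assms(1,2)] by simp
    ultimately show ?thesis
      using second_order_inertia[of ?J c0 "\<lambda>j. 1 / (4 * (dir \<theta> \<bullet> wavevec j)\<^sup>2)"] assms(3)
      by (simp add: linearisation_landau_field linearisation_spatial_field transpose_landau_matrix)
  qed
  moreover have "num_unstable ?J = 0 \<and> num_stable ?J = 3" if "pde_stable \<mu>0 \<beta>2 K0 K2 A"
  proof -
    have neg: "Re z < 0" if "is_eigenvalue ?J z" for z
      using \<open>pde_stable \<mu>0 \<beta>2 K0 K2 A\<close> that unfolding pde_stable_def by blast
    then have none: "{z. is_eigenvalue ?J z \<and> Re z > 0} = {}" by fastforce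
    have "num_unstable ?J = 0" unfolding num_unstable_def none by simp
    moreover have "num_stable ?J + num_unstable ?J = CARD(3)"
      unfolding num_stable_add_num_unstable_iff using neg by fastforce
    ultimately show ?thesis by simp
  qed
  ultimately show ?thesis by auto
qed

end
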